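(* Let $(X,d)$ be a metric space of positive dimension. Then there is an uncountable family of Borel subsets of $X$ that are pairwise incomparable with respect to continuous reducibility on $X$.
   Context: A topological space $X$ has dimension $0$ if for every $x\in X$ and every open set $U\subseteq X$ containing $x$, there is a subset of $U$ containing $x$ that is both open and closed in $X$. The space has positive dimension if it does not have dimension $0$. A metric space carries the topology induced by its metric. Borel subsets of a topological space are the elements of the least $\sigma$-algebra containing the open sets. For subsets $A,B$ of a topological space $X$, $A$ is reducible to $B$ (continuous reducibility) if $A=f^{-1}[B]$ for some continuous map $f\colon X\to X$. The sets $A,B$ are comparable if $A$ is reducible to $B$ or $B$ is reducible to $A$, and otherwise incomparable. A family of sets is pairwise incomparable if any two distinct members are incomparable. *)

theory Defs
  imports "HOL-Analysis.Analysis"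
begin

text \<open>A space is a type of class \<open>topological_space\<close>, i.e. the whole type is the space; a property
  of the space itself therefore takes the type as argument.\<close>

definition zero_dimensional :: "'a::topological_space itself \<Rightarrow> bool" where
  "zero_dimensional _ \<longleftrightarrow>
     (\<forall>(x::'a) U. open U \<and> x \<in> U \<longrightarrow> (\<exists>V. V \<subseteq> U \<and> x \<in> V \<and> open V \<and> closed V))"

definition positive_dimensional :: "'a::topological_space itself \<Rightarrow> bool" where
  "positive_dimensional X \<longleftrightarrow> \<not> zero_dimensional X"

definition reducible :: "'a::topological_space set \<Rightarrow> 'a set \<Rightarrow> bool" where
  "reducible A B \<longleftrightarrow> (\<exists>f::'a \<Rightarrow> 'a. continuous_on UNIV f \<and> A = f -` B)"

definition comparable :: "'a::topological_space set \<Rightarrow> 'a set \<Rightarrow> bool" where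
  "comparable A B \<longleftrightarrow> reducible A B \<or> reducible B A"

definition incomparable :: "'a::topological_space set \<Rightarrow> 'a set \<Rightarrow> bool" where
  "incomparable A B \<longleftrightarrow> \<not> comparable A B"

end

theory Submission
  imports Defs
begin

text \<open>
  Let \<open>x\<close> be a point and \<open>r\<close> a radius such that no set that is both open and closed contains \<open>x\<close> and
  lies in \<open>ball x r\<close>. Stretch the distance from \<open>x\<close>, so that the range \<open>[0, r)\<close> becomes \<open>[0, \<infinity>)\<close>, and
  follow it by the oscillation \<open>wave a t = t * (sin t - a)\<close> with \<open>\<bar>a\<bar> < 1\<close>. The set \<open>radial_set x r a\<close>
  consists of the points where the resulting value has odd integer part, together with all points
  outside the ball. It is Borel, and it remains to see that different parameters \<open>a\<close>, \<open>b\<close> give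
  incomparable sets.

  The half-open intervals \<open>[n, n + 1)\<close> with odd \<open>n\<close> make a reduction rigid. Suppose that \<open>f\<close> reduces
  the set of \<open>a\<close> to that of \<open>b\<close>. At every point \<open>z\<close> for which \<open>z\<close> and \<open>f z\<close> lie in the ball, let \<open>p\<close>
  be the value of the first oscillation at \<open>z\<close> and \<open>q\<close> that of the second one at \<open>f z\<close>. The integer
  parts of \<open>p\<close> and \<open>q\<close> have the same parity, so \<open>p - q\<close> is never an odd integer
  (\<open>diff_not_odd_if_same_parity\<close>). Hence the condition \<open>\<bar>p - q - 2 * k\<bar> < 1\<close> is both open and closed
  relative to the set of these \<open>z\<close>: when \<open>z\<close> moves, \<open>p\<close> and \<open>q\<close> have to rise and fall together, like two climbers who are tied to each
  other.

  The waves of \<open>a\<close> and \<open>b\<close> reach their new maxima and minima in incompatible proportions, since the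
  peaks of \<open>wave a\<close> have height about \<open>(1 - a) * t\<close> and its troughs have depth about \<open>(1 + a) * t\<close>.
  So there are arbitrarily late times \<open>u\<close> and \<open>v\<close> such that the first wave has, at time \<open>u\<close>, a peak far
  above everything that the second wave attains before \<open>v\<close>, while the second wave has, at time \<open>v\<close>, a
  trough far below everything that the first wave attains before \<open>u\<close>, or the same with peaks and
  troughs exchanged (\<open>waves_block\<close>). Neither climber can then be the first one to reach the obstacle,
  and the points \<open>z\<close> where both stay before it form an open and closed neighbourhood of \<open>x\<close> inside
  \<open>ball x r\<close> (\<open>clopen_if_blocked\<close>). This contradicts the choice of \<open>x\<close> and \<open>r\<close>. The argument
  works with clopen sets in place of connected ones because a space of positive dimension can be
  totally disconnected.
\<close>

section \<open>Oscillations with incompatible records\<close>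

definition wave :: "real \<Rightarrow> real \<Rightarrow> real" where
  "wave a t = t * (sin t - a)"

text \<open>The factor \<open>\<epsilon>\<close> treats peaks and troughs at once. Whether \<open>u\<close> is a peak or a trough of \<open>wave a\<close>
  depends on which of \<open>a\<close> and \<open>b\<close> is larger: the wave with the smaller parameter has the
  higher peaks and the shallower troughs. The obstacle of \<open>wave b\<close> is taken one half period after that
  of \<open>wave a\<close>. The delay costs a bounded amount, whereas the difference of the slopes gains
  \<open>u * \<bar>a - b\<bar>\<close>, which is unbounded in \<open>u\<close>.\<close>

lemma waves_block:
  assumes "\<bar>a\<bar> < 1" "\<bar>b\<bar> < 1" "a \<noteq> b"
  obtains \<epsilon> u v :: real where "\<bar>\<epsilon>\<bar> = 1" "u > c" "v > c" "u > 0" "v > 0"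
    "\<And>t. 0 \<le> t \<Longrightarrow> t \<le> v \<Longrightarrow> \<epsilon> * (wave a u - wave b t) > c"
    "\<And>t. 0 \<le> t \<Longrightarrow> t \<le> u \<Longrightarrow> \<epsilon> * (wave a t - wave b v) > c"
proof -
  define \<epsilon> :: real where "\<epsilon> = (if a < b then 1 else - 1)"
  define \<alpha> \<beta> where "\<alpha> = \<epsilon> * a" and "\<beta> = \<epsilon> * b"
  have eps: "\<bar>\<epsilon>\<bar> = 1"
    by (auto simp: \<epsilon>_def)
  have ab: "\<bar>\<alpha>\<bar> < 1" "\<bar>\<beta>\<bar> < 1" "\<alpha> < \<beta>"
    using assms by (auto simp: \<alpha>_def \<beta>_def \<epsilon>_def)
  have wave_eps: "\<epsilon> * wave a t = t * (\<epsilon> * sin t - \<alpha>)" "\<epsilon> * wave b t = t * (\<epsilon> * sin t - \<beta>)" for t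
    by (simp_all add: wave_def \<alpha>_def \<beta>_def algebra_simps)
  have sin_eps: "\<bar>\<epsilon> * sin t\<bar> \<le> 1" for t
    using abs_sin_le_one[of t] by (auto simp: \<epsilon>_def)
  have up: "\<epsilon> * wave b t \<le> v * (1 - \<beta>)" if "0 \<le> t" "t \<le> v" for t v
  proof -
    have "t * (\<epsilon> * sin t - \<beta>) \<le> t * (1 - \<beta>)"
      using that sin_eps[of t] by (intro mult_left_mono) auto
    also have "\<dots> \<le> v * (1 - \<beta>)"
      using that ab by (intro mult_right_mono) auto
    finally show ?thesis
      by (simp add: wave_eps)
  qed
  have down: "- (\<epsilon> * wave a t) \<le> u * (1 + \<alpha>)" if "0 \<le> t" "t \<le> u" for t u
  proof -
    have "t * (\<alpha> - \<epsilon> * sin t) \<le> t * (1 + \<alpha>)"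
      using that sin_eps[of t] by (intro mult_left_mono) auto
    also have "\<dots> \<le> u * (1 + \<alpha>)"
      using that ab by (intro mult_right_mono) auto
    finally show ?thesis
      unfolding wave_eps by (simp add: algebra_simps)
  qed
  obtain n :: nat where n: "real n > \<bar>c\<bar> + 2 * pi + (\<bar>c\<bar> + 2 * pi) / (\<beta> - \<alpha>)"
    using reals_Archimedean2 by blast
  define u where "u = \<epsilon> * (pi / 2) + real n * (2 * pi)"
  define v where "v = u + pi"
  have "\<epsilon> * (pi / 2) \<ge> - pi"
    by (auto simp: \<epsilon>_def)
  moreover have "real n * (2 * pi) \<ge> real n * 1"
    using pi_gt3 by (intro mult_left_mono) auto
  ultimately have u: "u > \<bar>c\<bar> + (\<bar>c\<bar> + 2 * pi) / (\<beta> - \<alpha>)"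
    unfolding u_def using n pi_gt_zero by linarith
  have quot: "(\<bar>c\<bar> + 2 * pi) / (\<beta> - \<alpha>) > 0"
    using ab pi_gt_zero by (intro divide_pos_pos add_nonneg_pos) auto
  have late: "u > \<bar>c\<bar>" "v > \<bar>c\<bar>"
    unfolding v_def using u quot pi_gt_zero by linarith+
  have gap: "u * (\<beta> - \<alpha>) > \<bar>c\<bar> + 2 * pi"
    using u ab by (simp add: pos_divide_less_eq[symmetric])
  have "sin u = sin (\<epsilon> * (pi / 2))"
    unfolding u_def using sin.plus_of_nat[of "\<epsilon> * (pi / 2)" n] by simp
  then have sin_u: "\<epsilon> * sin u = 1"
    by (auto simp: \<epsilon>_def)
  then have sin_v: "\<epsilon> * sin v = - 1"
    by (simp add: v_def)
  have at_u: "\<epsilon> * wave a u = u * (1 - \<alpha>)" and at_v: "\<epsilon> * wave b v = - (v * (1 + \<beta>))"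
    unfolding wave_eps sin_u sin_v by (simp_all add: algebra_simps)
  have "u * (1 - \<alpha>) - v * (1 - \<beta>) = u * (\<beta> - \<alpha>) - pi * (1 - \<beta>)"
    by (simp add: v_def algebra_simps)
  moreover have "pi * (1 - \<beta>) \<le> pi * 2" "pi * (1 + \<beta>) \<ge> 0"
    using ab by (intro mult_left_mono mult_nonneg_nonneg; simp)+
  moreover have "v * (1 + \<beta>) - u * (1 + \<alpha>) = u * (\<beta> - \<alpha>) + pi * (1 + \<beta>)"
    by (simp add: v_def algebra_simps)
  ultimately have margins: "u * (1 - \<alpha>) - v * (1 - \<beta>) > c" "v * (1 + \<beta>) - u * (1 + \<alpha>) > c"
    using gap pi_gt_zero by linarith+
  show ?thesis
  proof (rule that[of \<epsilon> u v])
    show "\<epsilon> * (wave a u - wave b t) > c" if "0 \<le> t" "t \<le> v" for t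
      using up[OF that] margins at_u by (simp add: right_diff_distrib)
    show "\<epsilon> * (wave a t - wave b v) > c" if "0 \<le> t" "t \<le> u" for t
      using down[OF that] margins at_v by (simp add: right_diff_distrib)
  qed (use eps late in auto)
qed

lemma diff_not_odd_if_same_parity:
  fixes p q :: real
  assumes "odd \<lfloor>p\<rfloor> \<longleftrightarrow> odd \<lfloor>q\<rfloor>" and "odd m"
  shows "p - q \<noteq> of_int m"
proof
  assume "p - q = of_int m"
  then have "p = q + of_int m"
    by simp
  then have "\<lfloor>p\<rfloor> = \<lfloor>q\<rfloor> + m"
    by simp
  with assms show False
    by simp
qed

section \<open>Stretching the radius of a ball\<close>

definition stretch :: "real \<Rightarrow> real \<Rightarrow> real" where
  "stretch r s = s / (r - s)"

lemma stretch_mono: "0 \<le> s \<Longrightarrow> s \<le> s' \<Longrightarrow> s' < r \<Longrightarrow> stretch r s \<le> stretch r s'"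
  unfolding stretch_def by (intro frac_le) auto

lemma stretch_nonneg: "0 \<le> s \<Longrightarrow> s < r \<Longrightarrow> 0 \<le> stretch r s"
  by (simp add: stretch_def)

lemma stretch_surj:
  assumes "0 < r" "0 < t"
  obtains s where "0 < s" "s < r" "stretch r s = t"
proof (rule that[of "r * t / (1 + t)"])
  have "r - r * t / (1 + t) = r / (1 + t)"
    using assms by (simp add: field_simps)
  then show "stretch r (r * t / (1 + t)) = t"
    using assms by (simp add: stretch_def)
qed (use assms in \<open>auto simp: field_simps\<close>)

lemma continuous_on_wave_stretch: "continuous_on {..<r} (\<lambda>s. wave a (stretch r s))"
  unfolding wave_def stretch_def by (intro continuous_intros) auto

section \<open>Trapping a reduction in a clopen neighbourhood\<close>

text \<open>The clopen set is where both climbers are before their obstacles, \<open>U\<close> for the first and \<open>V\<close>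
  for the second, and are within distance \<open>1\<close> after the shift by \<open>2 * k\<close>. Its defining inequalities
  can be taken strict or weak without changing the set: equality in the last one is excluded by
  parity, and equality in the first two by the blocking assumptions. The strict form is open and the
  weak form is closed.\<close>

lemma clopen_if_blocked:
  fixes g h :: "'a::topological_space \<Rightarrow> real" and P Q :: "real \<Rightarrow> real" and k :: int
  assumes cont: "continuous_on UNIV g" "continuous_on UNIV h"
      "continuous_on {..<r} P" "continuous_on {..<r} Q"
    and nonneg: "\<And>z. 0 \<le> g z" "\<And>z. 0 \<le> h z"
    and below: "U < r" "V < r"
    and parity: "\<And>z m. g z < r \<Longrightarrow> h z < r \<Longrightarrow> odd m \<Longrightarrow> P (g z) - Q (h z) \<noteq> of_int m"
    and start: "g x < U" "h x < V" "\<bar>P (g x) - Q (h x) - 2 * of_int k\<bar> < 1"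
    and block_U: "\<And>s. 0 \<le> s \<Longrightarrow> s \<le> V \<Longrightarrow> \<bar>P U - Q s - 2 * of_int k\<bar> > 1"
    and block_V: "\<And>s. 0 \<le> s \<Longrightarrow> s \<le> U \<Longrightarrow> \<bar>P s - Q V - 2 * of_int k\<bar> > 1"
  obtains C where "open C" "closed C" "x \<in> C" "C \<subseteq> {z. g z < U}"
proof -
  define D where "D z = P (g z) - Q (h z) - 2 * of_int k" for z
  define C where "C = {z. g z < U \<and> h z < V} \<inter> D -` {- 1<..<1}"
  have cont_D: "continuous_on S D" if "S \<subseteq> {z. g z < r \<and> h z < r}" for S
    unfolding D_def using that cont
    by (intro continuous_intros continuous_on_compose2[of "{..<r}" P S g]
        continuous_on_compose2[of "{..<r}" Q S h])
      (auto intro: continuous_on_subset)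
  have "C = {z. g z \<le> U \<and> h z \<le> V} \<inter> D -` {- 1..1}"
  proof (intro set_eqI iffI)
    fix z assume z: "z \<in> {z. g z \<le> U \<and> h z \<le> V} \<inter> D -` {- 1..1}"
    then have gh: "g z \<le> U" "h z \<le> V" and D: "\<bar>D z\<bar> \<le> 1"
      by auto
    have "g z \<noteq> U"
      using block_U[of "h z"] gh nonneg D by (auto simp: D_def)
    moreover have "h z \<noteq> V"
      using block_V[of "g z"] gh nonneg D by (auto simp: D_def)
    moreover have "D z \<noteq> 1" "D z \<noteq> - 1"
      using parity[of z "2 * k + 1"] parity[of z "2 * k - 1"] gh below by (auto simp: D_def)
    ultimately show "z \<in> C"
      using gh D by (auto simp: C_def)
  qed (auto simp: C_def)
  moreover have "closed ({z. g z \<le> U \<and> h z \<le> V} \<inter> D -` {- 1..1})"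
    using below cont(1,2)
    by (intro continuous_closed_preimage cont_D closed_Collect_conj closed_Collect_le
        continuous_on_const) auto
  ultimately have "closed C"
    by simp
  moreover have "open C"
    unfolding C_def using below cont(1,2)
    by (intro continuous_open_preimage cont_D open_Collect_conj open_Collect_less
        continuous_on_const) auto
  moreover have "x \<in> C"
    using start by (auto simp: C_def D_def)
  moreover have "C \<subseteq> {z. g z < U}"
    by (auto simp: C_def)
  ultimately show ?thesis
    using that by blast
qed

section \<open>The antichain\<close>

text \<open>The centre is outside the set and the complement of the ball is inside it. A reduction
  therefore sends the centre into the open ball, where the stretched radius is meaningful.\<close>

definition radial_set :: "'a::metric_space \<Rightarrow> real \<Rightarrow> real \<Rightarrow> 'a set" where
  "radial_set x r a = {z. r \<le> dist x z \<or> odd \<lfloor>wave a (stretch r (dist x z))\<rfloor>}"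

lemma radial_set_borel: "radial_set x r a \<in> sets borel"
proof -
  have "{s. r \<le> s \<or> odd \<lfloor>wave a (stretch r s)\<rfloor>} \<in> sets (borel :: real measure)"
    unfolding wave_def stretch_def by measurable
  moreover have "(\<lambda>z. dist x z) \<in> borel_measurable borel"
    by (intro borel_measurable_continuous_onI continuous_intros)
  ultimately have "(\<lambda>z. dist x z) -` {s. r \<le> s \<or> odd \<lfloor>wave a (stretch r s)\<rfloor>} \<inter> space borel
      \<in> sets borel"
    by (rule measurable_sets[rotated])
  then show ?thesis
    by (simp add: radial_set_def vimage_def)
qed

lemma radial_set_not_reducible:
  fixes x :: "'a::metric_space"
  assumes "0 < r"
    and no_clopen: "\<And>C. open C \<Longrightarrow> closed C \<Longrightarrow> x \<in> C \<Longrightarrow> \<not> C \<subseteq> ball x r"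
    and ab: "\<bar>a\<bar> < 1" "\<bar>b\<bar> < 1" "a \<noteq> b"
  shows "\<not> reducible (radial_set x r a) (radial_set x r b)"
proof
  assume "reducible (radial_set x r a) (radial_set x r b)"
  then obtain f where f: "continuous_on UNIV f" "radial_set x r a = f -` radial_set x r b"
    unfolding reducible_def by blast
  define g h where "g z = dist x z" and "h z = dist x (f z)" for z
  define P Q where "P s = wave a (stretch r s)" and "Q s = wave b (stretch r s)" for s
  have same: "r \<le> g z \<or> odd \<lfloor>P (g z)\<rfloor> \<longleftrightarrow> r \<le> h z \<or> odd \<lfloor>Q (h z)\<rfloor>" for z
    using f(2) unfolding radial_set_def g_def h_def P_def Q_def by blast
  have parity: "P (g z) - Q (h z) \<noteq> of_int m" if "g z < r" "h z < r" "odd m" for z m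
    using same[of z] that by (intro diff_not_odd_if_same_parity) auto
  have gx: "g x = 0" "P (g x) = 0"
    by (simp_all add: g_def P_def wave_def stretch_def)
  then have hx: "h x < r"
    using same[of x] \<open>0 < r\<close> by auto
  define k where "k = \<lfloor>(P (g x) - Q (h x) + 1) / 2\<rfloor>"
  have start: "\<bar>P (g x) - Q (h x) - 2 * of_int k\<bar> < 1"
  proof -
    have "of_int k \<le> (P (g x) - Q (h x) + 1) / 2" "(P (g x) - Q (h x) + 1) / 2 < of_int k + 1"
      unfolding k_def by linarith+
    moreover have "P (g x) - Q (h x) \<noteq> of_int (2 * k - 1)"
      using parity[of x "2 * k - 1"] gx(1) hx \<open>0 < r\<close> by auto
    ultimately show ?thesis
      by (simp add: field_simps abs_less_iff)
  qed
  \<comment> \<open>The bound exceeds the shift, so that blocking survives it, and the starting time of the second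
      wave, so that \<open>f x\<close> comes before the obstacle.\<close>
  define c where "c = 2 * \<bar>of_int k\<bar> + 1 + stretch r (h x)"
  have hx_nonneg: "0 \<le> stretch r (h x)"
    using hx by (intro stretch_nonneg) (auto simp: h_def)
  obtain \<epsilon> u v where eps: "\<bar>\<epsilon>\<bar> = 1" and uv: "u > c" "v > c" "u > 0" "v > 0"
    and block_u: "\<And>t. 0 \<le> t \<Longrightarrow> t \<le> v \<Longrightarrow> \<epsilon> * (wave a u - wave b t) > c"
    and block_v: "\<And>t. 0 \<le> t \<Longrightarrow> t \<le> u \<Longrightarrow> \<epsilon> * (wave a t - wave b v) > c"
    using waves_block[OF ab, of c] by blast
  obtain U where U: "0 < U" "U < r" "stretch r U = u"
    using stretch_surj \<open>0 < r\<close> \<open>u > 0\<close> by blast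
  obtain V where V: "0 < V" "V < r" "stretch r V = v"
    using stretch_surj \<open>0 < r\<close> \<open>v > 0\<close> by blast
  have far: "\<bar>y - 2 * of_int k\<bar> > 1" if "\<epsilon> * y > c" for y
  proof -
    have "\<bar>y\<bar> = \<bar>\<epsilon> * y\<bar>"
      using eps by (simp add: abs_mult)
    then show ?thesis
      using that hx_nonneg unfolding c_def by linarith
  qed
  have "h x < V"
  proof (rule ccontr)
    assume "\<not> h x < V"
    then have "v \<le> stretch r (h x)"
      using stretch_mono[of V "h x" r] V hx by simp
    with uv show False
      by (simp add: c_def)
  qed
  obtain C where C: "open C" "closed C" "x \<in> C" "C \<subseteq> {z. g z < U}"
  proof (rule clopen_if_blocked[of g h r P Q U V x k])
    show "continuous_on UNIV g" "continuous_on UNIV h"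
      unfolding g_def h_def using f(1) by (intro continuous_intros; assumption?)+
    show "continuous_on {..<r} P" "continuous_on {..<r} Q"
      unfolding P_def Q_def by (rule continuous_on_wave_stretch)+
    show "\<bar>P U - Q s - 2 * of_int k\<bar> > 1" if "0 \<le> s" "s \<le> V" for s
      using far[OF block_u[of "stretch r s"]] stretch_nonneg[of s r] stretch_mono[of s V r] that V U
      by (simp add: P_def Q_def)
    show "\<bar>P s - Q V - 2 * of_int k\<bar> > 1" if "0 \<le> s" "s \<le> U" for s
      using far[OF block_v[of "stretch r s"]] stretch_nonneg[of s r] stretch_mono[of s U r] that V U
      by (simp add: P_def Q_def)
    show "0 \<le> g z" "0 \<le> h z" for z
      by (simp_all add: g_def h_def)
  qed (use U V gx start parity \<open>h x < V\<close> in auto)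
  moreover have "{z. g z < U} \<subseteq> ball x r"
    using U by (auto simp: g_def)
  ultimately show False
    using no_clopen by blast
qed

theorem theorem1p5:
  assumes "positive_dimensional TYPE('a::metric_space)"
  shows "\<exists>\<F> :: 'a set set. uncountable \<F> \<and> \<F> \<subseteq> sets borel \<and> pairwise incomparable \<F>"
proof -
  obtain x :: 'a and W where W: "open W" "x \<in> W"
    and no_clopen: "\<And>C. C \<subseteq> W \<Longrightarrow> x \<in> C \<Longrightarrow> open C \<Longrightarrow> closed C \<Longrightarrow> False"
    using assms unfolding positive_dimensional_def zero_dimensional_def by blast
  obtain r where r: "0 < r" "ball x r \<subseteq> W"
    using W by (auto simp: open_contains_ball)
  define A where "A = radial_set x r"
  have not_red: "\<not> reducible (A a) (A b)" if "a \<in> {0<..<1}" "b \<in> {0<..<1}" "a \<noteq> b" for a b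
    unfolding A_def
  proof (rule radial_set_not_reducible)
    show "\<not> C \<subseteq> ball x r" if "open C" "closed C" "x \<in> C" for C
      using no_clopen[of C] that r by blast
  qed (use that r in auto)
  have "reducible S S" for S :: "'a set"
    unfolding reducible_def by (intro exI[of _ id]) (auto simp: continuous_on_id)
  with not_red have "inj_on A {0<..<1}"
    by (metis inj_onI)
  then have "uncountable (A ` {0<..<1})"
    using uncountable_open_interval[of 0 1] countable_image_inj_on by auto
  moreover have "A ` {0<..<1} \<subseteq> sets borel"
    by (auto simp: A_def radial_set_borel)
  moreover have "pairwise incomparable (A ` {0<..<1})"
    unfolding pairwise_def incomparable_def comparable_def using not_red by blast
  ultimately show ?thesis
    by blast
qed

end
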